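(* Let $f:(a,b)\to(0,\infty)$ be a twice differentiable convex function. Then $$I_{conv}(f)=\sup\left\{r\ge 1:\left(1-\frac1r\right)(f'(x))^2\le f(x)f''(x)\ \text{ for all } x\in(a,b)\right\}.$$ In particular, $(f'(x))^2\le f(x)f''(x)$ for all $x\in(a,b)$ if and only if $I_{conv}(f)=\infty$.
   Context: For a convex function $f:(a,b)\to(0,\infty)$, the set of convex exponents of $f$ is $C_{exp}(f)=\{r\ge 1 : x\mapsto (f(x))^{1/r}\text{ is convex}\}$ ($r$ real), and the index of convexity of $f$ is $I_{conv}(f)=\sup C_{exp}(f)\in[1,\infty]$. *)

theory Defs
  imports "HOL-Analysis.Analysis"
begin

definition convex_exponents :: "real set \<Rightarrow> (real \<Rightarrow> real) \<Rightarrow> real set" where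
  "convex_exponents S f = {r. r \<ge> 1 \<and> convex_on S (\<lambda>x. f x powr (1 / r))}"

text \<open>The supremum is taken in the extended reals, as it may be infinite. For convex positive
  \<open>f\<close> the set contains \<open>1\<close>, so the supremum of the empty set does not occur.\<close>

definition convexity_index :: "real set \<Rightarrow> (real \<Rightarrow> real) \<Rightarrow> ereal" where
  "convexity_index S f = Sup (ereal ` convex_exponents S f)"

end

theory Submission imports Defs begin

text \<open>For \<open>g = f powr (1 / r)\<close> one computes
  \<open>g'' = (1 / r) * f powr (1 / r - 2) * (f * f'' - (1 - 1 / r) * f'\<^sup>2)\<close>, so the convex exponents
  of \<open>f\<close> are exactly the \<open>r \<ge> 1\<close> satisfying the differential inequality. If the inequality holds
  for arbitrarily large \<open>r\<close>, letting \<open>r \<rightarrow> \<infinity>\<close> gives \<open>f'\<^sup>2 \<le> f * f''\<close>.\<close>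

lemma convex_einterval: "convex (einterval a b)"
proof -
  have "a < ereal z \<and> ereal z < b" if "a < ereal x" "ereal y < b" "x \<le> z" "z \<le> y" for x y z
    using less_le_trans[of a "ereal x" "ereal z"] le_less_trans[of "ereal z" "ereal y" b] that
    by simp
  then show ?thesis
    unfolding is_interval_convex_1[symmetric] is_interval_1 Ball_def einterval_iff by blast
qed

text \<open>For the direction from convexity to \<open>g''\<close>, the graph lies above each of its
  tangents; comparing the tangents at two points shows that \<open>g'\<close> is increasing, so its
  derivative is nonnegative.\<close>

lemma convex_on_iff_deriv2_nonneg:
  fixes g :: "real \<Rightarrow> real"
  assumes "open S" "convex S"
    and deriv1: "\<And>x. x \<in> S \<Longrightarrow> (g has_real_derivative g' x) (at x)"
    and deriv2: "\<And>x. x \<in> S \<Longrightarrow> (g' has_real_derivative g'' x) (at x)"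
  shows "convex_on S g \<longleftrightarrow> (\<forall>x\<in>S. 0 \<le> g'' x)"
proof
  assume "\<forall>x\<in>S. 0 \<le> g'' x"
  then show "convex_on S g"
    using assms by (intro f''_ge0_imp_convex[where f' = g' and f'' = g'']) auto
next
  assume convex: "convex_on S g"
  have tangent: "g y - g x \<ge> g' x * (y - x)" if "x \<in> S" "y \<in> S" for x y
    using that assms
    by (intro convex_on_imp_above_tangent[OF convex])
      (auto simp: convex_connected interior_open intro: has_field_derivative_at_within)
  have "mono_on S g'"
  proof (rule mono_onI)
    fix x y assume xy: "x \<in> S" "y \<in> S" "x \<le> y"
    \<comment> \<open>Sum of the tangent inequality at \<open>x\<close> evaluated in
      \<open>y\<close> and the one at \<open>y\<close> evaluated in \<open>x\<close>: the values of
      \<open>g\<close> cancel.\<close>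
    have "(g' y - g' x) * (y - x) \<ge> 0"
      using tangent[of x y] tangent[of y x] xy by (simp add: algebra_simps)
    with xy show "g' x \<le> g' y"
      by (cases "x = y") (auto simp: zero_le_mult_iff)
  qed
  then show "\<forall>x\<in>S. 0 \<le> g'' x"
    using mono_on_imp_deriv_nonneg deriv2 \<open>open S\<close> by (metis interior_open)
qed

text \<open>Positivity of \<open>f\<close> makes the power differentiable, and together with
  \<open>s > 0\<close> it makes the factor \<open>s * f x powr (s - 2)\<close> of the second
  derivative strictly positive. Cancelling that factor is therefore an equivalence.\<close>

lemma convex_on_powr_iff:
  fixes f :: "real \<Rightarrow> real"
  assumes "open S" "convex S" "s > 0"
    and pos: "\<And>x. x \<in> S \<Longrightarrow> f x > 0"
    and deriv1: "\<And>x. x \<in> S \<Longrightarrow> (f has_real_derivative f' x) (at x)"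
    and deriv2: "\<And>x. x \<in> S \<Longrightarrow> (f' has_real_derivative f'' x) (at x)"
  shows "convex_on S (\<lambda>x. f x powr s) \<longleftrightarrow> (\<forall>x\<in>S. (1 - s) * (f' x)\<^sup>2 \<le> f x * f'' x)"
proof -
  define g' where "g' x = s * f x powr (s - 1) * f' x" for x
  define g'' where "g'' x = s * f x powr (s - 2) * (f x * f'' x - (1 - s) * (f' x)\<^sup>2)" for x
  have "((\<lambda>x. f x powr s) has_real_derivative g' x) (at x)" if "x \<in> S" for x
    unfolding g'_def using pos[OF that] deriv1[OF that] by (auto intro!: derivative_eq_intros)
  moreover have "(g' has_real_derivative g'' x) (at x)" if "x \<in> S" for x
  proof -
    \<comment> \<open>Lowering the exponent lets \<open>f x powr (s - 2)\<close> factor out of the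
      whole derivative of \<open>g'\<close>; the spare \<open>f x\<close> ends up next to
      \<open>f'' x\<close>.\<close>
    have "f x powr (s - 1) = f x powr (s - 2) * f x"
      using pos[OF that] powr_add[of "f x" "s - 2" 1] by simp
    then show ?thesis
      unfolding g'_def g''_def using pos[OF that] deriv1[OF that] deriv2[OF that]
      by (auto intro!: derivative_eq_intros simp: algebra_simps power2_eq_square)
  qed
  ultimately have "convex_on S (\<lambda>x. f x powr s) \<longleftrightarrow> (\<forall>x\<in>S. 0 \<le> g'' x)"
    using assms(1,2) by (intro convex_on_iff_deriv2_nonneg)
  also have "\<dots> \<longleftrightarrow> (\<forall>x\<in>S. (1 - s) * (f' x)\<^sup>2 \<le> f x * f'' x)"
  proof (rule ball_cong[OF refl])
    fix x assume "x \<in> S"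
    then have "s * f x powr (s - 2) > 0"
      using pos[of x] \<open>s > 0\<close> by simp
    from mult_le_cancel_left_pos[OF this, of 0 "f x * f'' x - (1 - s) * (f' x)\<^sup>2"]
    show "0 \<le> g'' x \<longleftrightarrow> (1 - s) * (f' x)\<^sup>2 \<le> f x * f'' x"
      by (simp only: g''_def mult_zero_right diff_ge_0_iff_ge)
  qed
  finally show ?thesis .
qed

text \<open>Restates an infinite index as unboundedness tested on naturals, so that the limit in
  \<open>r\<close> can be taken along a sequence.\<close>

lemma Sup_ereal_image_eq_PInfty_iff:
  "Sup (ereal ` A) = \<infinity> \<longleftrightarrow> (\<forall>n::nat. \<exists>r\<in>A. real n \<le> r)"
proof
  assume "Sup (ereal ` A) = \<infinity>"
  then have "\<forall>n::nat. ereal (real n) < Sup (ereal ` A)"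
    by simp
  then show "\<forall>n::nat. \<exists>r\<in>A. real n \<le> r"
    unfolding less_Sup_iff by (auto intro: less_imp_le)
next
  assume "\<forall>n::nat. \<exists>r\<in>A. real n \<le> r"
  then show "Sup (ereal ` A) = \<infinity>"
    by (intro SUP_PInfty) auto
qed

theorem theorem3p1:
  fixes a b :: ereal and f f' f'' :: "real \<Rightarrow> real"
  assumes "a < b"
    and pos: "\<And>x. x \<in> einterval a b \<Longrightarrow> f x > 0"
    and convex: "convex_on (einterval a b) f"
    and deriv1: "\<And>x. x \<in> einterval a b \<Longrightarrow> (f has_real_derivative f' x) (at x)"
    and deriv2: "\<And>x. x \<in> einterval a b \<Longrightarrow> (f' has_real_derivative f'' x) (at x)"
  shows "convexity_index (einterval a b) f =
           Sup (ereal ` {r. r \<ge> 1 \<and>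
             (\<forall>x\<in>einterval a b. (1 - 1 / r) * (f' x)\<^sup>2 \<le> f x * f'' x)}) \<and>
         ((\<forall>x\<in>einterval a b. (f' x)\<^sup>2 \<le> f x * f'' x) \<longleftrightarrow>
           convexity_index (einterval a b) f = \<infinity>)"
proof -
  define S where "S = einterval a b"
  define E where "E = {r. r \<ge> 1 \<and> (\<forall>x\<in>S. (1 - 1 / r) * (f' x)\<^sup>2 \<le> f x * f'' x)}"
  have "convex_on S (\<lambda>x. f x powr (1 / r)) \<longleftrightarrow>
      (\<forall>x\<in>S. (1 - 1 / r) * (f' x)\<^sup>2 \<le> f x * f'' x)" if "r \<ge> 1" for r
    unfolding S_def using that pos deriv1 deriv2
    by (intro convex_on_powr_iff) (auto simp: convex_einterval)
  then have "convex_exponents S f = E"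
    unfolding convex_exponents_def E_def by auto
  then have index: "convexity_index S f = Sup (ereal ` E)"
    by (simp add: convexity_index_def)
  have "(\<forall>x\<in>S. (f' x)\<^sup>2 \<le> f x * f'' x) \<longleftrightarrow> (\<forall>n::nat. \<exists>r\<in>E. real n \<le> r)"
  proof (intro iffI allI ballI)
    fix n :: nat
    assume le: "\<forall>x\<in>S. (f' x)\<^sup>2 \<le> f x * f'' x"
    \<comment> \<open>The witness is \<open>real n + 1\<close> because members of \<open>E\<close>
      must be at least 1, also when \<open>n = 0\<close>.\<close>
    have "(1 - 1 / (real n + 1)) * (f' x)\<^sup>2 \<le> f x * f'' x" if "x \<in> S" for x
      using mult_right_mono[of "1 - 1 / (real n + 1)" 1 "(f' x)\<^sup>2"] le that by force
    then have "real n + 1 \<in> E"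
      by (simp add: E_def)
    then show "\<exists>r\<in>E. real n \<le> r"
      by (rule bexI[rotated]) simp
  next
    fix x
    assume unbounded: "\<forall>n::nat. \<exists>r\<in>E. real n \<le> r" and "x \<in> S"
    \<comment> \<open>The coefficient \<open>1 - 1 / r\<close> increases with \<open>r\<close>, so
      the inequality for some \<open>r\<close> in \<open>E\<close> above \<open>Suc n\<close>
      descends to \<open>Suc n\<close> itself. Starting at \<open>Suc n\<close> keeps the
      denominator positive.\<close>
    have "(1 - 1 / real (Suc n)) * (f' x)\<^sup>2 \<le> f x * f'' x" for n
    proof -
      obtain r where r: "r \<in> E" "real (Suc n) \<le> r"
        using unbounded by blast
      have "1 / r \<le> 1 / real (Suc n)"
        using r(2) by (intro divide_left_mono) auto
      then have "(1 - 1 / real (Suc n)) * (f' x)\<^sup>2 \<le> (1 - 1 / r) * (f' x)\<^sup>2"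
        by (intro mult_right_mono) auto
      with r(1) \<open>x \<in> S\<close> show ?thesis
        unfolding E_def by force
    qed
    \<comment> \<open>For fixed \<open>x\<close> the right-hand side does not depend on
      \<open>n\<close>, so the bound survives the limit.\<close>
    moreover have "(\<lambda>n. (1 - 1 / real (Suc n)) * (f' x)\<^sup>2) \<longlonglongrightarrow> (1 - 0) * (f' x)\<^sup>2"
      by (intro tendsto_intros LIMSEQ_Suc[OF lim_1_over_n])
    ultimately show "(f' x)\<^sup>2 \<le> f x * f'' x"
      using LIMSEQ_le_const2 by fastforce
  qed
  then show ?thesis
    using index Sup_ereal_image_eq_PInfty_iff[of E] by (simp add: S_def E_def)
qed

end
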